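(* Let $(W,S)$ be a Coxeter system. The set $\mathcal I$ of perfect involutions in $W^+$, with $W$ acting by conjugation ($w\cdot\iota=w\iota w^{-1}$) and height function $\mathrm{ht}(\iota)=\ell(\iota)/2$, is a quasiparabolic $W$-set.
   Context: Coxeter systems $(W,S)$ have finite rank; $R(W)$ is the set of reflections, i.e. conjugates in $W$ of elements of $S$. $W^+$ denotes the semidirect product of $W$ by the group of permutations of $S$ that induce Coxeter automorphisms of $W$ (diagram automorphisms); the length function $\ell$ of $W$ is extended to $W^+$ by giving diagram automorphisms length $0$, i.e. $\ell(w\phi)=\ell(w)$ for $w\in W$ and $\phi$ a diagram automorphism (equivalently, $\ell$ counts the positive roots sent to negative roots). An involution means an element $\iota\in W^+$ with $\iota^2=1$ (the identity is allowed). An involution $\iota\in W^+$ is perfect if for all $r\in R(W)$, $r$ commutes with $\iota r\iota$. A scaled $W$-set is a pair $(X,\mathrm{ht})$ with $X$ a (left) $W$-set and $\mathrm{ht}$ an integer-valued function on $X$ with $|\mathrm{ht}(sx)-\mathrm{ht}(x)|\le 1$ for all $s\in S$, $x\in X$; here, by convention, one only requires that on each $W$-orbit the height takes values in a fixed coset of $\mathbb Z$ (so that half-integral heights are allowed). A quasiparabolic $W$-set is a scaled $W$-set such that (QP1) for all $r\in R(W)$, $x\in X$, if $\mathrm{ht}(rx)=\mathrm{ht}(x)$ then $rx=x$; and (QP2) for all $r\in R(W)$, $x\in X$, $s\in S$, if $\mathrm{ht}(rx)>\mathrm{ht}(x)$ and $\mathrm{ht}(srx)<\mathrm{ht}(sx)$,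 then $rx=sx$. *)

theory Defs
  imports Complex_Main "HOL-Algebra.Multiplicative_Group" "HOL-Algebra.Group_Action"
begin

section \<open>Coxeter systems\<close>

definition word_eval :: "('a, 'b) monoid_scheme \<Rightarrow> 'a list \<Rightarrow> 'a" where
  "word_eval W u = foldr (\<lambda>s x. s \<otimes>\<^bsub>W\<^esub> x) u \<one>\<^bsub>W\<^esub>"

text \<open>
  The congruence on words over \<open>S\<close> generated by the Coxeter relations
  \<open>(s t) ^ m(s,t) = 1\<close>, where \<open>m(s,t)\<close> is the order of \<open>s t\<close> in \<open>W\<close>.
  \<^const>\<open>group.ord\<close> is \<open>0\<close> for elements of infinite order, so that the relation
  is void in that case. For \<open>s = t\<close> the order is \<open>1\<close> and the relation is \<open>s s = 1\<close>;
  hence every generator is its own inverse, the quotient of the free monoid on \<open>S\<close> by this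
  congruence is the group presented by the Coxeter relations, and no formal inverses
  are needed.
\<close>

inductive coxeter_cong :: "('a, 'b) monoid_scheme \<Rightarrow> 'a set \<Rightarrow> 'a list \<Rightarrow> 'a list \<Rightarrow> bool"
  for W :: "('a, 'b) monoid_scheme" and S :: "'a set" where
  relator: "\<lbrakk>s \<in> S; t \<in> S\<rbrakk> \<Longrightarrow>
      coxeter_cong W S (concat (replicate (group.ord W (s \<otimes>\<^bsub>W\<^esub> t)) [s, t])) []"
| refl: "u \<in> lists S \<Longrightarrow> coxeter_cong W S u u"
| sym: "coxeter_cong W S u v \<Longrightarrow> coxeter_cong W S v u"
| trans: "\<lbrakk>coxeter_cong W S u v; coxeter_cong W S v w\<rbrakk> \<Longrightarrow> coxeter_cong W S u w"
| in_context: "\<lbrakk>coxeter_cong W S u v; x \<in> lists S; y \<in> lists S\<rbrakk> \<Longrightarrow>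
      coxeter_cong W S (x @ u @ y) (x @ v @ y)"

locale coxeter_system = group W for W (structure) and S +
  assumes finite_rank: "finite S"
    and generators_closed: "S \<subseteq> carrier W"
    and generators_order: "s \<in> S \<Longrightarrow> ord s = 2"
    and generates: "generate W S = carrier W"
    and presentation: "\<lbrakk>u \<in> lists S; v \<in> lists S; word_eval W u = word_eval W v\<rbrakk> \<Longrightarrow>
      coxeter_cong W S u v"

definition cox_length :: "('a, 'b) monoid_scheme \<Rightarrow> 'a set \<Rightarrow> 'a \<Rightarrow> nat" where
  "cox_length W S w = (LEAST n. \<exists>u \<in> lists S. length u = n \<and> word_eval W u = w)"

definition reflections :: "('a, 'b) monoid_scheme \<Rightarrow> 'a set \<Rightarrow> 'a set" where
  "reflections W S = {w \<otimes>\<^bsub>W\<^esub> s \<otimes>\<^bsub>W\<^esub> inv\<^bsub>W\<^esub> w | w s. w \<in> carrier W \<and> s \<in> S}"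


section \<open>The extended group\<close>

definition diagram_perms :: "('a, 'b) monoid_scheme \<Rightarrow> 'a set \<Rightarrow> ('a \<Rightarrow> 'a) set" where
  "diagram_perms W S = {\<pi> \<in> Bij S. \<exists>f \<in> auto W. \<forall>s \<in> S. f s = \<pi> s}"

definition induced_auto :: "('a, 'b) monoid_scheme \<Rightarrow> 'a set \<Rightarrow> ('a \<Rightarrow> 'a) \<Rightarrow> 'a \<Rightarrow> 'a" where
  "induced_auto W S \<pi> = (THE f. f \<in> auto W \<and> (\<forall>s \<in> S. f s = \<pi> s))"

definition extended_group :: "('a, 'b) monoid_scheme \<Rightarrow> 'a set \<Rightarrow> ('a \<times> ('a \<Rightarrow> 'a)) monoid" where
  "extended_group W S =
    \<lparr>carrier = carrier W \<times> diagram_perms W S,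
     mult = (\<lambda>(w, \<pi>) (v, \<sigma>). (w \<otimes>\<^bsub>W\<^esub> induced_auto W S \<pi> v, compose S \<pi> \<sigma>)),
     one = (\<one>\<^bsub>W\<^esub>, \<lambda>s\<in>S. s)\<rparr>"

definition ext_embed :: "'a set \<Rightarrow> 'a \<Rightarrow> 'a \<times> ('a \<Rightarrow> 'a)" where
  "ext_embed S w = (w, \<lambda>s\<in>S. s)"

definition ext_length :: "('a, 'b) monoid_scheme \<Rightarrow> 'a set \<Rightarrow> 'a \<times> ('a \<Rightarrow> 'a) \<Rightarrow> nat" where
  "ext_length W S g = cox_length W S (fst g)"

definition perfect_involutions ::
    "('a, 'b) monoid_scheme \<Rightarrow> 'a set \<Rightarrow> ('a \<times> ('a \<Rightarrow> 'a)) set" where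
  "perfect_involutions W S =
    (let P = extended_group W S in
     {\<iota> \<in> carrier P. \<iota> \<otimes>\<^bsub>P\<^esub> \<iota> = \<one>\<^bsub>P\<^esub> \<and>
       (\<forall>r \<in> ext_embed S ` reflections W S.
          r \<otimes>\<^bsub>P\<^esub> (\<iota> \<otimes>\<^bsub>P\<^esub> r \<otimes>\<^bsub>P\<^esub> \<iota>) = (\<iota> \<otimes>\<^bsub>P\<^esub> r \<otimes>\<^bsub>P\<^esub> \<iota>) \<otimes>\<^bsub>P\<^esub> r)})"

text \<open>
  Restricted to \<open>X\<close> because \<^const>\<open>BijGroup\<close>, and hence \<^locale>\<open>group_action\<close>, uses
  extensional functions.
\<close>

definition ext_conjugation :: "('a, 'b) monoid_scheme \<Rightarrow> 'a set \<Rightarrow> ('a \<times> ('a \<Rightarrow> 'a)) set \<Rightarrow>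
    'a \<Rightarrow> 'a \<times> ('a \<Rightarrow> 'a) \<Rightarrow> 'a \<times> ('a \<Rightarrow> 'a)" where
  "ext_conjugation W S X w =
    (let P = extended_group W S in
     (\<lambda>\<iota>\<in>X. ext_embed S w \<otimes>\<^bsub>P\<^esub> \<iota> \<otimes>\<^bsub>P\<^esub> inv\<^bsub>P\<^esub> (ext_embed S w)))"


section \<open>Quasiparabolic sets\<close>

text \<open>
  Heights are real-valued; on each orbit they lie in a single coset of the integers.
\<close>

definition scaled_set :: "('a, 'b) monoid_scheme \<Rightarrow> 'a set \<Rightarrow> 'x set \<Rightarrow> ('a \<Rightarrow> 'x \<Rightarrow> 'x) \<Rightarrow>
    ('x \<Rightarrow> real) \<Rightarrow> bool" where
  "scaled_set W S X \<phi> ht \<longleftrightarrow>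
     group_action W X \<phi> \<and>
     (\<forall>w \<in> carrier W. \<forall>x \<in> X. ht (\<phi> w x) - ht x \<in> \<int>) \<and>
     (\<forall>s \<in> S. \<forall>x \<in> X. \<bar>ht (\<phi> s x) - ht x\<bar> \<le> 1)"

definition quasiparabolic_set :: "('a, 'b) monoid_scheme \<Rightarrow> 'a set \<Rightarrow> 'x set \<Rightarrow>
    ('a \<Rightarrow> 'x \<Rightarrow> 'x) \<Rightarrow> ('x \<Rightarrow> real) \<Rightarrow> bool" where
  "quasiparabolic_set W S X \<phi> ht \<longleftrightarrow>
     scaled_set W S X \<phi> ht \<and>
     (\<forall>r \<in> reflections W S. \<forall>x \<in> X. ht (\<phi> r x) = ht x \<longrightarrow> \<phi> r x = x) \<and>
     (\<forall>r \<in> reflections W S. \<forall>x \<in> X. \<forall>s \<in> S.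
        ht (\<phi> r x) > ht x \<and> ht (\<phi> s (\<phi> r x)) < ht (\<phi> s x) \<longrightarrow> \<phi> r x = \<phi> s x)"


section \<open>Well-definedness of the extended group\<close>

context coxeter_system
begin

lemma auto_eqI:
  assumes f: "f \<in> auto W" and g: "g \<in> auto W" and eq: "\<And>s. s \<in> S \<Longrightarrow> f s = g s"
  shows "f = g"
proof (rule extensionalityI)
  show "f \<in> extensional (carrier W)" "g \<in> extensional (carrier W)"
    using f g by (auto simp: auto_def Bij_def)
next
  interpret f: group_hom W W f
    using f by unfold_locales (auto simp: auto_def)
  interpret g: group_hom W W g
    using g by unfold_locales (auto simp: auto_def)
  fix x assume "x \<in> carrier W"
  then have "x \<in> generate W S"
    by (simp add: generates)
  then show "f x = g x"
  proof (induction rule: generate.induct)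
    case (inv h)
    then show ?case
      using generators_closed eq by (metis f.hom_inv g.hom_inv subsetD)
  next
    case (eng h1 h2)
    then show ?case
      using generate_in_carrier[OF generators_closed] by (metis f.hom_mult g.hom_mult)
  qed (auto simp: eq)
qed

lemma induced_auto:
  assumes "\<pi> \<in> diagram_perms W S"
  shows "induced_auto W S \<pi> \<in> auto W" and "s \<in> S \<Longrightarrow> induced_auto W S \<pi> s = \<pi> s"
proof -
  have "\<exists>!f. f \<in> auto W \<and> (\<forall>s \<in> S. f s = \<pi> s)"
    using assms by (auto simp: diagram_perms_def intro: auto_eqI)
  from theI'[OF this] show "induced_auto W S \<pi> \<in> auto W"
    and "s \<in> S \<Longrightarrow> induced_auto W S \<pi> s = \<pi> s"
    by (auto simp: induced_auto_def)
qed

lemma induced_auto_eqI: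
  assumes "\<pi> \<in> diagram_perms W S" "f \<in> auto W" "\<And>s. s \<in> S \<Longrightarrow> f s = \<pi> s"
  shows "induced_auto W S \<pi> = f"
  using assms induced_auto by (intro auto_eqI) auto

lemma induced_auto_closed:
  "\<pi> \<in> diagram_perms W S \<Longrightarrow> x \<in> carrier W \<Longrightarrow> induced_auto W S \<pi> x \<in> carrier W"
  using induced_auto(1) by (auto simp: auto_def hom_def)

lemma auto_compose: "f \<in> auto W \<Longrightarrow> g \<in> auto W \<Longrightarrow> compose (carrier W) f g \<in> auto W"
  using compose_Bij[of f "carrier W" g]
  by (auto simp: auto_def hom_def compose_def Pi_def)

lemma diagram_perms_id: "(\<lambda>s\<in>S. s) \<in> diagram_perms W S"
  using generators_closed
  by (auto simp: diagram_perms_def id_Bij intro!: bexI[OF _ id_in_auto])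

lemma induced_auto_id: "induced_auto W S (\<lambda>s\<in>S. s) = (\<lambda>x\<in>carrier W. x)"
  using generators_closed by (intro induced_auto_eqI diagram_perms_id id_in_auto) auto

lemma diagram_perms_apply: "\<pi> \<in> diagram_perms W S \<Longrightarrow> s \<in> S \<Longrightarrow> \<pi> s \<in> S"
  using Bij_imp_funcset by (force simp: diagram_perms_def)

lemma
  assumes \<pi>: "\<pi> \<in> diagram_perms W S" and \<sigma>: "\<sigma> \<in> diagram_perms W S"
  shows diagram_perms_compose: "compose S \<pi> \<sigma> \<in> diagram_perms W S"
    and induced_auto_compose: "induced_auto W S (compose S \<pi> \<sigma>) =
      compose (carrier W) (induced_auto W S \<pi>) (induced_auto W S \<sigma>)"
proof -
  let ?h = "compose (carrier W) (induced_auto W S \<pi>) (induced_auto W S \<sigma>)"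
  have h: "?h \<in> auto W"
    using \<pi> \<sigma> by (intro auto_compose induced_auto)
  have hs: "?h s = compose S \<pi> \<sigma> s" if "s \<in> S" for s
    using that \<pi> \<sigma> generators_closed
    by (auto simp: compose_def induced_auto diagram_perms_apply)
  show c: "compose S \<pi> \<sigma> \<in> diagram_perms W S"
    using \<pi> \<sigma> h hs by (auto simp: diagram_perms_def intro!: compose_Bij)
  show "induced_auto W S (compose S \<pi> \<sigma>) = ?h"
    by (rule induced_auto_eqI[OF c h hs])
qed

lemma diagram_perms_inverse:
  assumes \<pi>: "\<pi> \<in> diagram_perms W S"
  obtains \<sigma> where "\<sigma> \<in> diagram_perms W S" "compose S \<sigma> \<pi> = (\<lambda>s\<in>S. s)"
proof
  let ?f = "induced_auto W S \<pi>"
  let ?\<sigma> = "restrict (inv_into S \<pi>) S"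
  let ?g = "restrict (inv_into (carrier W) ?f) (carrier W)"
  have B: "\<pi> \<in> Bij S"
    using \<pi> by (simp add: diagram_perms_def)
  have f: "?f \<in> hom W W" "?f \<in> Bij (carrier W)"
    using induced_auto[OF \<pi>] by (auto simp: auto_def)
  have g: "?g \<in> auto W"
    using restrict_inv_into_hom[OF f] restrict_inv_into_Bij[OF f(2)] by (simp add: auto_def)
  have "?g s = ?\<sigma> s" if s: "s \<in> S" for s
  proof -
    obtain t where t: "t \<in> S" "s = \<pi> t"
      using s B by (auto simp: Bij_def bij_betw_def)
    have "inv_into S \<pi> s = t"
      using t B by (auto simp: Bij_def bij_betw_def)
    moreover have "inv_into (carrier W) ?f (?f t) = t"
      using t f generators_closed by (intro inv_into_f_f) (auto simp: Bij_def bij_betw_def)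
    ultimately show ?thesis
      using s t generators_closed induced_auto(2)[OF \<pi> t(1)] by auto
  qed
  then show "?\<sigma> \<in> diagram_perms W S"
    using g restrict_inv_into_Bij[OF B] unfolding diagram_perms_def by blast
  show "compose S ?\<sigma> \<pi> = (\<lambda>s\<in>S. s)"
    by (rule Bij_compose_restrict_eq[OF B])
qed

lemma group_extended_group: "group (extended_group W S)"
proof (rule groupI)
  fix x y assume "x \<in> carrier (extended_group W S)" "y \<in> carrier (extended_group W S)"
  then show "x \<otimes>\<^bsub>extended_group W S\<^esub> y \<in> carrier (extended_group W S)"
    by (auto simp: extended_group_def diagram_perms_compose induced_auto_closed)
next
  show "\<one>\<^bsub>extended_group W S\<^esub> \<in> carrier (extended_group W S)"
    by (auto simp: extended_group_def diagram_perms_id)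
next
  fix x y z assume "x \<in> carrier (extended_group W S)" "y \<in> carrier (extended_group W S)"
    "z \<in> carrier (extended_group W S)"
  then obtain u \<pi> v \<sigma> w \<tau> where xyz: "x = (u, \<pi>)" "y = (v, \<sigma>)" "z = (w, \<tau>)"
    and c: "u \<in> carrier W" "v \<in> carrier W" "w \<in> carrier W"
    and d: "\<pi> \<in> diagram_perms W S" "\<sigma> \<in> diagram_perms W S" "\<tau> \<in> diagram_perms W S"
    by (auto simp: extended_group_def)
  have cl: "induced_auto W S \<sigma> w \<in> carrier W" "induced_auto W S \<pi> v \<in> carrier W"
    "induced_auto W S \<pi> (induced_auto W S \<sigma> w) \<in> carrier W"
    using c d by (auto simp: induced_auto_closed)
  have h: "induced_auto W S \<pi> (v \<otimes> induced_auto W S \<sigma> w) =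
      induced_auto W S \<pi> v \<otimes> induced_auto W S \<pi> (induced_auto W S \<sigma> w)"
    using induced_auto(1)[OF d(1)] c cl by (auto simp: auto_def hom_def)
  have "compose S (compose S \<pi> \<sigma>) \<tau> = compose S \<pi> (compose S \<sigma> \<tau>)"
    using d diagram_perms_apply by (intro compose_assoc[symmetric]) auto
  then show "x \<otimes>\<^bsub>extended_group W S\<^esub> y \<otimes>\<^bsub>extended_group W S\<^esub> z =
      x \<otimes>\<^bsub>extended_group W S\<^esub> (y \<otimes>\<^bsub>extended_group W S\<^esub> z)"
    using c d cl h
    by (simp add: xyz extended_group_def induced_auto_compose compose_eq m_assoc)
next
  fix x assume "x \<in> carrier (extended_group W S)"
  then show "\<one>\<^bsub>extended_group W S\<^esub> \<otimes>\<^bsub>extended_group W S\<^esub> x = x"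
    by (auto simp: extended_group_def induced_auto_id diagram_perms_def
        intro!: Id_compose Bij_imp_funcset Bij_imp_extensional)
next
  fix x assume "x \<in> carrier (extended_group W S)"
  then obtain u \<pi> where x: "x = (u, \<pi>)" "u \<in> carrier W" "\<pi> \<in> diagram_perms W S"
    by (auto simp: extended_group_def)
  obtain \<sigma> where \<sigma>: "\<sigma> \<in> diagram_perms W S" "compose S \<sigma> \<pi> = (\<lambda>s\<in>S. s)"
    using diagram_perms_inverse[OF x(3)] .
  have "induced_auto W S \<sigma> u \<in> carrier W"
    using \<sigma> x by (auto simp: induced_auto_closed)
  then show "\<exists>y\<in>carrier (extended_group W S).
      y \<otimes>\<^bsub>extended_group W S\<^esub> x = \<one>\<^bsub>extended_group W S\<^esub>"
    using x \<sigma>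
    by (intro bexI[of _ "(inv (induced_auto W S \<sigma> u), \<sigma>)"]) (auto simp: extended_group_def)
qed

end

end

theory Submission
  imports Defs
begin

text \<open>
  Tits' reflection cocycle assigns to \<open>w \<in> W\<close> the set \<open>N(w)\<close> of elements occurring an odd number
  of times among \<open>s\<^sub>1, s\<^sub>1 s\<^sub>2 s\<^sub>1, \<dots>\<close>, for any word \<open>s\<^sub>1 s\<^sub>2 \<dots>\<close> for \<open>w\<close>; it satisfies
  \<open>N(uv) = N(u) \<triangle> u N(v) u\<inverse>\<close>, and a reflection \<open>r\<close> lies in \<open>N(w)\<close> iff \<open>\<ell>(rw) < \<ell>(w)\<close>.
  A reflection distinct from \<open>r\<close> and commuting with it is never in \<open>N(r)\<close>, the combinatorial form
  of the orthogonality of the two roots.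

  Write an involution of \<open>W\<^sup>+\<close> as \<open>\<iota> = wf\<close> with \<open>w \<in> W\<close> and \<open>f\<close> a diagram automorphism, and let
  \<open>t = \<iota>r\<iota>\<close>, so that \<open>r\<iota>r = rtw f\<close>. If \<open>r \<noteq> t\<close>, then \<open>r\<close> and \<open>t\<close> move the length in the same
  direction, so \<open>\<ell>(rtw)\<close> differs from \<open>\<ell>(w)\<close> by at least two; this is (QP1). In (QP2) the lengths
  along \<open>w, tw, rtw\<close> increase by exactly one. The analogue of (QP2) for the regular representation,
  applied either to the step from \<open>tw\<close> to \<open>rtw\<close> or to the step from \<open>w\<close> to \<open>tw\<close>, yields \<open>r = s\<close>
  or \<open>t = s\<close>, and in both cases \<open>r\<iota>r = s\<iota>s\<close>.
\<close>

section \<open>The reflection cocycle\<close>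

text \<open>Shifting by the period pairs the solutions below \<open>m\<close> with those from
  \<open>m\<close> on. It is applied with \<open>m\<close> the order of
  \<open>s \<otimes> t\<close>, whose powers repeat after \<open>m\<close> steps.\<close>

lemma even_card_periodic:
  fixes P :: "nat \<Rightarrow> bool"
  assumes "\<And>j. P (j + m) = P j"
  shows "even (card {j. j < 2 * m \<and> P j})"
proof -
  let ?A = "{j. j < m \<and> P j}"
  have "{j. j < 2 * m \<and> P j} = ?A \<union> (\<lambda>j. j + m) ` ?A"
  proof (intro equalityI subsetI)
    fix j assume j: "j \<in> {j. j < 2 * m \<and> P j}"
    show "j \<in> ?A \<union> (\<lambda>j. j + m) ` ?A"
    proof (cases "j < m")
      case False
      then have "j = (j - m) + m" "j - m < m" using j by auto
      moreover have "P (j - m)" using assms[of "j - m"] j False by simp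
      ultimately show ?thesis by blast
    qed (use j in auto)
  qed (auto simp: assms)
  moreover have "card (?A \<union> (\<lambda>j. j + m) ` ?A) = card ?A + card ((\<lambda>j. j + m) ` ?A)"
    by (intro card_Un_disjoint) auto
  moreover have "card ((\<lambda>j. j + m) ` ?A) = card ?A"
    by (intro card_image) (auto simp: inj_on_def)
  ultimately show ?thesis by simp
qed

lemma odd_card_Suc:
  "odd (card {j. j < Suc n \<and> P j}) \<longleftrightarrow> odd (card {j. j < n \<and> P j}) \<noteq> P n"
proof -
  have "{j. j < Suc n \<and> P j} = (if P n then insert n {j. j < n \<and> P j} else {j. j < n \<and> P j})"
    by (auto simp: less_Suc_eq)
  then show ?thesis by simp
qed

lemma (in group) inv_cancel_left [simp]:
  assumes "x \<in> carrier G" "y \<in> carrier G"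
  shows "x \<otimes> (inv x \<otimes> y) = y" "inv x \<otimes> (x \<otimes> y) = y"
  using assms by (simp_all add: m_assoc[symmetric])

lemma (in group) conj_eq_iff:
  assumes "d \<in> carrier G" "x \<in> carrier G" "z \<in> carrier G"
  shows "inv d \<otimes> x \<otimes> d = z \<longleftrightarrow> x = d \<otimes> z \<otimes> inv d"
  using assms by (auto simp: m_assoc)

context coxeter_system
begin

section \<open>Words in the generators and their values\<close>

lemma S_carrier [simp]: "s \<in> S \<Longrightarrow> s \<in> carrier W"
  using generators_closed by auto

lemma S_square [simp]: "s \<in> S \<Longrightarrow> s \<otimes> s = \<one>"
  using generators_order[of s] pow_ord_eq_1[of s] by (simp add: numeral_2_eq_2)

lemma S_inv [simp]: "s \<in> S \<Longrightarrow> inv s = s"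
  by (rule inv_equality) simp_all

lemma S_cancel [simp]: "s \<in> S \<Longrightarrow> x \<in> carrier W \<Longrightarrow> s \<otimes> (s \<otimes> x) = x"
  by (simp add: m_assoc[symmetric])

lemma word_eval_Nil [simp]: "word_eval W [] = \<one>"
  by (simp add: word_eval_def)

lemma word_eval_Cons [simp]: "word_eval W (s # u) = s \<otimes> word_eval W u"
  by (simp add: word_eval_def)

lemma word_eval_closed [simp]: "u \<in> lists S \<Longrightarrow> word_eval W u \<in> carrier W"
  by (induction u) auto

lemma word_eval_append [simp]:
  "u \<in> lists S \<Longrightarrow> v \<in> lists S \<Longrightarrow> word_eval W (u @ v) = word_eval W u \<otimes> word_eval W v"
  by (induction u) (auto simp: m_assoc)

lemma word_eval_rev: "u \<in> lists S \<Longrightarrow> word_eval W (rev u) = inv (word_eval W u)"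
proof (induction u)
  case (Cons s u)
  moreover have "rev u \<in> lists S" using Cons.prems by auto
  ultimately show ?case by (simp add: inv_mult_group)
qed simp

lemma ex_word:
  assumes "x \<in> carrier W"
  shows "\<exists>u \<in> lists S. word_eval W u = x"
proof -
  have "x \<in> generate W S" using assms generates by simp
  then show ?thesis
  proof (induction rule: generate.induct)
    case one
    then show ?case by (intro bexI[of _ "[]"]) auto
  next
    case (incl h)
    then show ?case by (intro bexI[of _ "[h]"]) auto
  next
    case (inv h)
    then show ?case by (intro bexI[of _ "[h]"]) auto
  next
    case (eng h1 h2)
    then obtain u v where "u \<in> lists S" "v \<in> lists S" "word_eval W u = h1" "word_eval W v = h2"
      by blast
    then show ?case by (intro bexI[of _ "u @ v"]) auto
  qed
qed

text \<open>The parity of occurrences of \<open>x\<close> among the conjugates attached to the word: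
  stripping the first letter conjugates the remaining ones by it. The inequality of Booleans is
  exclusive or, that is, addition modulo 2.\<close>

primrec word_cocycle :: "'a list \<Rightarrow> 'a \<Rightarrow> bool" where
  "word_cocycle [] x = False"
| "word_cocycle (s # u) x = ((x = s) \<noteq> word_cocycle u (s \<otimes> x \<otimes> s))"

lemma word_cocycle_append:
  assumes "u \<in> lists S" "v \<in> lists S" "x \<in> carrier W"
  shows "word_cocycle (u @ v) x \<longleftrightarrow>
    word_cocycle u x \<noteq> word_cocycle v (inv (word_eval W u) \<otimes> x \<otimes> word_eval W u)"
  using assms
proof (induction u arbitrary: x rule: list.induct)
  case (Cons s u)
  then have "word_cocycle (u @ v) (s \<otimes> x \<otimes> s) \<longleftrightarrow> word_cocycle u (s \<otimes> x \<otimes> s) \<noteq>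
      word_cocycle v (inv (word_eval W u) \<otimes> (s \<otimes> x \<otimes> s) \<otimes> word_eval W u)"
    by auto
  moreover have "inv (word_eval W u) \<otimes> (s \<otimes> x \<otimes> s) \<otimes> word_eval W u =
      inv (s \<otimes> word_eval W u) \<otimes> x \<otimes> (s \<otimes> word_eval W u)"
    using Cons.prems by (simp add: inv_mult_group m_assoc)
  ultimately show ?case by simp blast
qed auto

lemma word_eval_power:
  "s \<in> S \<Longrightarrow> t \<in> S \<Longrightarrow> word_eval W (concat (replicate m [s, t])) = (s \<otimes> t) [^] m"
proof (induction m)
  case (Suc m)
  then show ?case by (subst nat_pow_Suc2) (simp_all add: m_assoc)
qed simp

text \<open>Conjugation by \<open>s\<close> inverts \<open>s \<otimes> t\<close>, so equal powers on
  the two sides of \<open>s\<close> cancel.\<close>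

lemma dihedral_swap:
  assumes "s \<in> S" "t \<in> S"
  shows "(s \<otimes> t) [^] (n::nat) \<otimes> s \<otimes> (s \<otimes> t) [^] n = s"
proof (induction n)
  case (Suc n)
  let ?c = "s \<otimes> t"
  have "?c [^] Suc n \<otimes> s \<otimes> ?c [^] Suc n = ?c [^] n \<otimes> (?c \<otimes> s \<otimes> ?c) \<otimes> ?c [^] n"
    using assms by (subst (2) nat_pow_Suc2) (auto simp: m_assoc)
  also have "?c \<otimes> s \<otimes> ?c = s"
    using assms by (simp add: m_assoc)
  finally show ?case using Suc by simp
qed (use assms in auto)

text \<open>The conjugates attached to the alternating word are the dihedral elements
  \<open>(s \<otimes> t) [^] j \<otimes> s\<close>, in order of \<open>j\<close>, with possible
  repetitions.\<close>

lemma word_cocycle_power: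
  assumes st: "s \<in> S" "t \<in> S" and x: "x \<in> carrier W"
  shows "word_cocycle (concat (replicate m [s, t])) x \<longleftrightarrow>
    odd (card {j. j < 2 * m \<and> x = (s \<otimes> t) [^] j \<otimes> s})"
proof (induction m)
  case (Suc m)
  let ?c = "s \<otimes> t"
  let ?d = "?c [^] m"
  let ?y = "inv ?d \<otimes> x \<otimes> ?d"
  have c [simp]: "?c \<in> carrier W" using st by simp
  have inj: "?y = z \<longleftrightarrow> x = ?d \<otimes> z \<otimes> inv ?d" if "z \<in> carrier W" for z
    using that x by (simp add: conj_eq_iff)
  have sw: "s \<otimes> inv ?d = ?d \<otimes> s"
    using dihedral_swap[OF st, of m] st by (simp add: inv_solve_right')
  \<comment> \<open>The new block is appended on the right, so its letters contribute the conjugates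
    by \<open>?d\<close> of \<open>s\<close> and of \<open>s \<otimes> t \<otimes> s\<close>. They
    are the values at \<open>j = 2 * m\<close> and \<open>j = Suc (2 * m)\<close>.\<close>
  have e1: "?d \<otimes> s \<otimes> inv ?d = ?c [^] (2 * m) \<otimes> s"
    using st sw by (simp add: m_assoc nat_pow_mult[symmetric] mult_2)
  have e2: "?d \<otimes> (s \<otimes> t \<otimes> s) \<otimes> inv ?d = ?c [^] Suc (2 * m) \<otimes> s"
  proof -
    have "?d \<otimes> (s \<otimes> t \<otimes> s) \<otimes> inv ?d = ?d \<otimes> ?c \<otimes> (s \<otimes> inv ?d)"
      using st by (simp add: m_assoc)
    also have "\<dots> = (?c [^] Suc m \<otimes> ?d) \<otimes> s"
      using st by (simp add: sw m_assoc)
    also have "?c [^] Suc m \<otimes> ?d = ?c [^] Suc (2 * m)"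
      by (subst nat_pow_mult) (auto simp: mult_2 simp del: nat_pow_Suc)
    finally show ?thesis .
  qed
  have "word_cocycle [s, t] ?y \<longleftrightarrow> (?y = s) \<noteq> (s \<otimes> ?y \<otimes> s = t)"
    by simp
  also have "s \<otimes> ?y \<otimes> s = t \<longleftrightarrow> ?y = s \<otimes> t \<otimes> s"
  proof
    assume "s \<otimes> ?y \<otimes> s = t"
    then have "s \<otimes> (s \<otimes> ?y \<otimes> s) \<otimes> s = s \<otimes> t \<otimes> s" by simp
    then show "?y = s \<otimes> t \<otimes> s" using st x by (simp add: m_assoc)
  next
    assume "?y = s \<otimes> t \<otimes> s"
    then show "s \<otimes> ?y \<otimes> s = t" using st by (simp add: m_assoc)
  qed
  finally have two: "word_cocycle [s, t] ?y \<longleftrightarrow>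
      (x = ?c [^] (2 * m) \<otimes> s) \<noteq> (x = ?c [^] Suc (2 * m) \<otimes> s)"
    using inj[of s] inj[of "s \<otimes> t \<otimes> s"] e1 e2 st by simp
  have "concat (replicate (Suc m) [s, t]) = concat (replicate m [s, t]) @ [s, t]"
    by (simp flip: replicate_append_same del: replicate.simps add: replicate_Suc)
  moreover have "concat (replicate m [s, t]) \<in> lists S"
    using st by (induction m) auto
  ultimately have "word_cocycle (concat (replicate (Suc m) [s, t])) x \<longleftrightarrow>
      word_cocycle (concat (replicate m [s, t])) x \<noteq> word_cocycle [s, t] ?y"
    using word_cocycle_append[of "concat (replicate m [s, t])" "[s, t]" x] st x
    by (simp only: word_eval_power[OF st]) simp
  moreover have "2 * Suc m = Suc (Suc (2 * m))" by simp
  ultimately show ?case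
    unfolding Suc two by (simp only: odd_card_Suc) blast
qed simp

text \<open>A relator has even length, value 1 and, by periodicity, a vanishing cocycle. The
  equality of values belongs to the same induction because the cocycle of an appended word depends
  on the value of its first part.\<close>

lemma coxeter_cong_invariants:
  assumes "coxeter_cong W S u v"
  shows "u \<in> lists S \<and> v \<in> lists S \<and> word_eval W u = word_eval W v \<and>
    (even (length u) \<longleftrightarrow> even (length v)) \<and>
    (\<forall>x \<in> carrier W. word_cocycle u x = word_cocycle v x)"
  using assms
proof (induction rule: coxeter_cong.induct)
  case (relator s t)
  let ?m = "ord (s \<otimes> t)"
  have st: "s \<in> S" "t \<in> S" "s \<otimes> t \<in> carrier W" using relator by auto
  have l: "concat (replicate n [s, t]) \<in> lists S \<and> even (length (concat (replicate n [s, t])))" for n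
    using st by (induction n) auto
  have p: "(s \<otimes> t) [^] ?m = \<one>" using st by (simp add: pow_ord_eq_1)
  have "\<not> word_cocycle (concat (replicate ?m [s, t])) x" if "x \<in> carrier W" for x
    using word_cocycle_power[OF st(1,2) that, of ?m] st p
      even_card_periodic[of "\<lambda>j. x = (s \<otimes> t) [^] j \<otimes> s" ?m]
    by (simp add: nat_pow_mult[symmetric])
  then show ?case
    using l p st by (simp add: word_eval_power)
next
  case (in_context u v x y)
  then have "word_cocycle (x @ u @ y) z = word_cocycle (x @ v @ y) z" if "z \<in> carrier W" for z
    using that by (auto simp: word_cocycle_append)
  then show ?case using in_context by auto
qed auto

section \<open>Descent of the cocycle from words to group elements\<close>

definition cocycle :: "'a \<Rightarrow> 'a \<Rightarrow> bool" where
  "cocycle w = word_cocycle (SOME u. u \<in> lists S \<and> word_eval W u = w)"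

text \<open>By the presentation, words with the same value are congruent, hence have the same
  cocycle; the choice of a word in \<open>cocycle\<close> is immaterial.\<close>

lemma cocycle_word_eval:
  assumes "u \<in> lists S" "x \<in> carrier W"
  shows "cocycle (word_eval W u) x = word_cocycle u x"
proof -
  let ?v = "SOME v. v \<in> lists S \<and> word_eval W v = word_eval W u"
  have v: "?v \<in> lists S \<and> word_eval W ?v = word_eval W u"
    by (rule someI[of _ u]) (use assms in auto)
  then have "coxeter_cong W S ?v u"
    using assms presentation by auto
  then show ?thesis
    using coxeter_cong_invariants assms unfolding cocycle_def by blast
qed

lemma cocycle_mult:
  assumes "u \<in> carrier W" "v \<in> carrier W" "x \<in> carrier W"
  shows "cocycle (u \<otimes> v) x \<longleftrightarrow> cocycle u x \<noteq> cocycle v (inv u \<otimes> x \<otimes> u)"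
proof -
  obtain a b where "a \<in> lists S" "word_eval W a = u" "b \<in> lists S" "word_eval W b = v"
    using ex_word assms by metis
  then show ?thesis
    using assms cocycle_word_eval[of "a @ b" x] cocycle_word_eval[of a x]
      cocycle_word_eval[of b "inv u \<otimes> x \<otimes> u"] word_cocycle_append[of a b x] by simp
qed

lemma cocycle_gen: "s \<in> S \<Longrightarrow> x \<in> carrier W \<Longrightarrow> cocycle s x \<longleftrightarrow> x = s"
  using cocycle_word_eval[of "[s]" x] by simp

lemma cocycle_one: "x \<in> carrier W \<Longrightarrow> \<not> cocycle \<one> x"
  using cocycle_word_eval[of "[]" x] by simp

lemma cocycle_inv:
  assumes "u \<in> carrier W" "x \<in> carrier W"
  shows "cocycle (inv u) x \<longleftrightarrow> cocycle u (u \<otimes> x \<otimes> inv u)"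
  using cocycle_mult[of "inv u" u x] cocycle_one[of x] assms by simp


section \<open>Reflections and length\<close>

lemma reflectionE:
  assumes "r \<in> reflections W S"
  obtains u s where "u \<in> carrier W" "s \<in> S" "r = u \<otimes> s \<otimes> inv u"
  using assms unfolding reflections_def by blast

lemma reflection_closed [simp]: "r \<in> reflections W S \<Longrightarrow> r \<in> carrier W"
  by (auto simp: reflections_def)

lemma reflection_square [simp]: "r \<in> reflections W S \<Longrightarrow> r \<otimes> r = \<one>"
  by (elim reflectionE) (simp add: m_assoc)

lemma reflection_inv [simp]: "r \<in> reflections W S \<Longrightarrow> inv r = r"
  by (rule inv_equality) simp_all

lemma reflection_cancel [simp]:
  "r \<in> reflections W S \<Longrightarrow> x \<in> carrier W \<Longrightarrow> r \<otimes> (r \<otimes> x) = x"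
  using inv_cancel_left(1)[of r x] by simp

lemma S_reflection [simp]: "s \<in> S \<Longrightarrow> s \<in> reflections W S"
  unfolding reflections_def by (rule CollectI, rule exI[of _ \<one>], rule exI[of _ s]) auto

lemma reflection_conj:
  assumes "r \<in> reflections W S" "v \<in> carrier W"
  shows "v \<otimes> r \<otimes> inv v \<in> reflections W S"
proof -
  obtain u s where us: "u \<in> carrier W" "s \<in> S" "r = u \<otimes> s \<otimes> inv u"
    using assms(1) by (rule reflectionE)
  then have "v \<otimes> r \<otimes> inv v = (v \<otimes> u) \<otimes> s \<otimes> inv (v \<otimes> u)"
    using assms by (simp add: m_assoc inv_mult_group)
  then show ?thesis using us assms unfolding reflections_def by blast
qed

text \<open>For \<open>r = u \<otimes> s \<otimes> inv u\<close> the product formula has three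
  terms. The outer two are \<open>cocycle u\<close> at \<open>x\<close> and at
  \<open>r \<otimes> x \<otimes> r\<close>; they cancel when \<open>x\<close> commutes with
  \<open>r\<close>, leaving the middle term of \<open>s\<close>.\<close>

lemma cocycle_reflection_commuting:
  assumes r: "r \<in> reflections W S" and x: "x \<in> carrier W" and comm: "r \<otimes> x = x \<otimes> r"
  shows "cocycle r x \<longleftrightarrow> x = r"
proof -
  obtain u s where us: "u \<in> carrier W" "s \<in> S" "r = u \<otimes> s \<otimes> inv u"
    using r by (rule reflectionE)
  let ?y = "inv u \<otimes> x \<otimes> u"
  have y: "?y \<in> carrier W" using us x by simp
  have "cocycle r x \<longleftrightarrow> cocycle (u \<otimes> s) x \<noteq> cocycle (inv u) (inv (u \<otimes> s) \<otimes> x \<otimes> (u \<otimes> s))"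
    using cocycle_mult[of "u \<otimes> s" "inv u" x] us x by simp
  also have "cocycle (u \<otimes> s) x \<longleftrightarrow> cocycle u x \<noteq> (?y = s)"
    using cocycle_mult[of u s x] cocycle_gen us x by simp
  also have "cocycle (inv u) (inv (u \<otimes> s) \<otimes> x \<otimes> (u \<otimes> s)) \<longleftrightarrow>
      cocycle u (u \<otimes> (inv (u \<otimes> s) \<otimes> x \<otimes> (u \<otimes> s)) \<otimes> inv u)"
    using cocycle_inv us x by simp
  also have "u \<otimes> (inv (u \<otimes> s) \<otimes> x \<otimes> (u \<otimes> s)) \<otimes> inv u = r \<otimes> x \<otimes> r"
    using us x by (simp add: m_assoc inv_mult_group)
  also have "r \<otimes> x \<otimes> r = x"
    using r x by (simp add: comm m_assoc)
  also have "?y = s \<longleftrightarrow> x = r"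
    using us x by (simp add: conj_eq_iff)
  finally show ?thesis by blast
qed

section \<open>Length: parity, inverses and multiplication by generators\<close>

lemma cox_length_ex:
  assumes "w \<in> carrier W"
  obtains u where "u \<in> lists S" "length u = cox_length W S w" "word_eval W u = w"
proof -
  have "\<exists>n. \<exists>u \<in> lists S. length u = n \<and> word_eval W u = w"
    using ex_word[OF assms] by blast
  from LeastI_ex[OF this] show thesis
    using that unfolding cox_length_def by blast
qed

lemma cox_length_le: "u \<in> lists S \<Longrightarrow> cox_length W S (word_eval W u) \<le> length u"
  unfolding cox_length_def by (rule Least_le) blast

lemma word_parity:
  assumes "u \<in> lists S"
  shows "even (cox_length W S (word_eval W u)) \<longleftrightarrow> even (length u)"
  using assms cox_length_ex[OF word_eval_closed[OF assms]] presentation coxeter_cong_invariants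
  by metis

lemma cox_length_parity:
  assumes "u \<in> carrier W" "v \<in> carrier W"
  shows "even (cox_length W S (u \<otimes> v)) \<longleftrightarrow> even (cox_length W S u + cox_length W S v)"
proof -
  obtain a b where "a \<in> lists S" "word_eval W a = u" "b \<in> lists S" "word_eval W b = v"
    using ex_word assms by metis
  then show ?thesis
    using word_parity[of a] word_parity[of b] word_parity[of "a @ b"] by auto
qed

lemma cox_length_inv:
  assumes "w \<in> carrier W"
  shows "cox_length W S (inv w) = cox_length W S w"
proof -
  have le: "cox_length W S (inv v) \<le> cox_length W S v" if "v \<in> carrier W" for v
  proof -
    obtain u where u: "u \<in> lists S" "length u = cox_length W S v" "word_eval W u = v"
      using cox_length_ex \<open>v \<in> carrier W\<close> by blast
    then have "rev u \<in> lists S" by auto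
    from cox_length_le[OF this] show ?thesis
      unfolding word_eval_rev[OF u(1)] u(3) length_rev u(2) .
  qed
  show ?thesis
    using le[of w] le[of "inv w"] assms by simp
qed

lemma cox_length_gen_mult_le:
  assumes "s \<in> S" "w \<in> carrier W"
  shows "cox_length W S (s \<otimes> w) \<le> cox_length W S w + 1"
proof -
  obtain u where "u \<in> lists S" "length u = cox_length W S w" "word_eval W u = w"
    using cox_length_ex assms by blast
  then show ?thesis
    using cox_length_le[of "s # u"] assms by simp
qed

lemma cox_length_gen_mult_ge:
  assumes "s \<in> S" "w \<in> carrier W"
  shows "cox_length W S w \<le> cox_length W S (s \<otimes> w) + 1"
  using cox_length_gen_mult_le[of s "s \<otimes> w"] assms by simp

lemma cox_length_mult_gen_le:
  assumes "s \<in> S" "w \<in> carrier W"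
  shows "cox_length W S (w \<otimes> s) \<le> cox_length W S w + 1"
  using cox_length_gen_mult_le[of s "inv w"] cox_length_inv[of "w \<otimes> s"] cox_length_inv[of w] assms
  by (simp add: inv_mult_group)

lemma cox_length_mult_gen_ge:
  assumes "s \<in> S" "w \<in> carrier W"
  shows "cox_length W S w \<le> cox_length W S (w \<otimes> s) + 1"
  using cox_length_mult_gen_le[of s "w \<otimes> s"] assms by (simp add: m_assoc)

text \<open>The exchange condition: an odd count is nonzero, so \<open>x\<close> is one of the
  attached conjugates, and multiplying by it deletes the corresponding letter.\<close>

lemma word_exchange:
  assumes "u \<in> lists S" "x \<in> carrier W" "word_cocycle u x"
  shows "\<exists>v \<in> lists S. length v < length u \<and> word_eval W v = x \<otimes> word_eval W u"
  using assms
proof (induction u arbitrary: x rule: list.induct)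
  case (Cons s u)
  show ?case
  proof (cases "x = s")
    case True
    then show ?thesis using Cons.prems by (intro bexI[of _ u]) auto
  next
    case False
    then have "word_cocycle u (s \<otimes> x \<otimes> s)" using Cons.prems by simp
    then obtain v where v: "v \<in> lists S" "length v < length u"
      "word_eval W v = (s \<otimes> x \<otimes> s) \<otimes> word_eval W u"
      using Cons.IH[of "s \<otimes> x \<otimes> s"] Cons.prems by auto
    then have "word_eval W (s # v) = x \<otimes> word_eval W (s # u)"
      using Cons.prems by (simp add: m_assoc)
    then show ?thesis using v Cons.prems by (intro bexI[of _ "s # v"]) auto
  qed
qed simp

lemma cox_length_less_if_cocycle:
  assumes "w \<in> carrier W" "x \<in> carrier W" "cocycle w x"
  shows "cox_length W S (x \<otimes> w) < cox_length W S w"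
proof -
  obtain u where u: "u \<in> lists S" "length u = cox_length W S w" "word_eval W u = w"
    using cox_length_ex assms by blast
  then have "word_cocycle u x" using assms cocycle_word_eval by blast
  then show ?thesis
    using word_exchange[of u x] cox_length_le u assms by (metis le_less_trans)
qed

text \<open>Multiplication by \<open>r\<close> toggles the cocycle at \<open>r\<close>, so the
  decreasing case applies to \<open>r \<otimes> w\<close>.\<close>

lemma cox_length_greater_if_not_cocycle:
  assumes "w \<in> carrier W" "r \<in> reflections W S" "\<not> cocycle w r"
  shows "cox_length W S (r \<otimes> w) > cox_length W S w"
proof -
  have "cocycle (r \<otimes> w) r"
    using assms cocycle_mult[of r w r] cocycle_reflection_commuting[of r r] by simp
  then show ?thesis
    using cox_length_less_if_cocycle[of "r \<otimes> w" r] assms by simp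
qed

lemma cocycle_iff_cox_length:
  assumes "w \<in> carrier W" "r \<in> reflections W S"
  shows "cocycle w r \<longleftrightarrow> cox_length W S (r \<otimes> w) < cox_length W S w"
  using cox_length_less_if_cocycle[of w r] cox_length_greater_if_not_cocycle[of w r] assms
  by (meson less_asym reflection_closed)

text \<open>The reflection \<open>s \<otimes> r \<otimes> s\<close> lies in the cocycle of
  \<open>s \<otimes> x\<close>, whereas \<open>r\<close> does not lie in that of \<open>x\<close>.
  Left multiplication by \<open>s\<close> transports the cocycle by conjugation except at
  \<open>s\<close> itself, so \<open>s \<otimes> r \<otimes> s = s\<close>.\<close>

lemma regular_QP2:
  assumes x: "x \<in> carrier W" and r: "r \<in> reflections W S" and s: "s \<in> S"
    and up: "cox_length W S x < cox_length W S (r \<otimes> x)"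
    and down: "cox_length W S (s \<otimes> (r \<otimes> x)) < cox_length W S (s \<otimes> x)"
  shows "r = s"
proof -
  have refl: "s \<otimes> r \<otimes> s \<in> reflections W S"
    using reflection_conj[of r s] r s by simp
  have "(s \<otimes> r \<otimes> s) \<otimes> (s \<otimes> x) = s \<otimes> (r \<otimes> x)"
    using x r s by (simp add: m_assoc)
  then have "cocycle (s \<otimes> x) (s \<otimes> r \<otimes> s)"
    using down cocycle_iff_cox_length[of "s \<otimes> x", OF _ refl] x s by simp
  moreover have "s \<otimes> (s \<otimes> r \<otimes> s) \<otimes> s = r"
    using r s by (simp add: m_assoc)
  moreover have "\<not> cocycle x r"
    using up cocycle_iff_cox_length[OF x r] by simp
  ultimately have "s \<otimes> r \<otimes> s = s"
    using cocycle_mult[of s x "s \<otimes> r \<otimes> s"] cocycle_gen[of s "s \<otimes> r \<otimes> s"] x r s by simp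
  then have "s \<otimes> (s \<otimes> r \<otimes> s) \<otimes> s = s"
    using s by simp
  then show ?thesis
    using \<open>s \<otimes> (s \<otimes> r \<otimes> s) \<otimes> s = r\<close> by simp
qed

end


section \<open>Perfect twisted involutions\<close>

text \<open>The element \<open>w f\<close> of \<open>W\<^sup>+\<close> is a perfect involution.\<close>

locale perfect_twisted_involution = coxeter_system +
  fixes f :: "'a \<Rightarrow> 'a" and w :: 'a
  assumes f_hom: "f \<in> hom W W"
    and f_S: "s \<in> S \<Longrightarrow> f s \<in> S"
    and f_f [simp]: "x \<in> carrier W \<Longrightarrow> f (f x) = x"
    and w_closed [simp]: "w \<in> carrier W"
    and w_f: "w \<otimes> f w = \<one>"
    and perfect: "r \<in> reflections W S \<Longrightarrow>
      r \<otimes> (w \<otimes> f r \<otimes> inv w) = (w \<otimes> f r \<otimes> inv w) \<otimes> r"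
begin

sublocale f: group_hom W W f
  by unfold_locales (rule f_hom)

text \<open>Conjugation by the involution, restricted to \<open>W\<close>; \<open>twist r\<close> is
  the \<open>t\<close> of the overview.\<close>

definition twist :: "'a \<Rightarrow> 'a" where
  "twist x = w \<otimes> f x \<otimes> inv w"

lemma f_w: "f w = inv w"
  using w_f by (metis f.hom_closed inv_comm inv_equality w_closed)

lemma twist_closed [simp]: "x \<in> carrier W \<Longrightarrow> twist x \<in> carrier W"
  by (simp add: twist_def)

lemma twist_twist:
  assumes "x \<in> carrier W"
  shows "twist (twist x) = x"
  using assms by (simp add: twist_def f.hom_mult f.hom_inv f_w m_assoc)

lemma twist_mult_w: "x \<in> carrier W \<Longrightarrow> twist x \<otimes> w = w \<otimes> f x"
  by (simp add: twist_def m_assoc)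

lemma twist_reflection:
  assumes "r \<in> reflections W S"
  shows "twist r \<in> reflections W S"
proof -
  obtain u s where us: "u \<in> carrier W" "s \<in> S" "r = u \<otimes> s \<otimes> inv u"
    using assms by (rule reflectionE)
  have "f r = f u \<otimes> f s \<otimes> inv (f u)"
    using us by (simp add: f.hom_mult f.hom_inv)
  then have "f r \<in> reflections W S"
    using us f_S reflection_conj[of "f s" "f u"] by simp
  then show ?thesis
    using reflection_conj[of "f r" w] by (simp add: twist_def)
qed

text \<open>Replaces the two-sided action by two left multiplications, whose effect on length the
  cocycle controls.\<close>

lemma conj_eq_twist: "x \<in> carrier W \<Longrightarrow> x \<otimes> w \<otimes> f x = x \<otimes> (twist x \<otimes> w)"
  by (simp add: m_assoc twist_mult_w)

lemma cox_length_f: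
  assumes "x \<in> carrier W"
  shows "cox_length W S (f x) = cox_length W S x"
proof -
  have le: "cox_length W S (f v) \<le> cox_length W S v" if "v \<in> carrier W" for v
  proof -
    have ev: "word_eval W (map f u) = f (word_eval W u)" if "u \<in> lists S" for u
      using that by (induction u) (auto simp: f.hom_mult)
    obtain u where "u \<in> lists S" "length u = cox_length W S v" "word_eval W u = v"
      using cox_length_ex \<open>v \<in> carrier W\<close> by blast
    moreover have "map f u \<in> lists S"
      using \<open>u \<in> lists S\<close> f_S by auto
    ultimately show ?thesis
      using cox_length_le[of "map f u"] ev by simp
  qed
  show ?thesis
    using le[of x] le[of "f x"] assms by simp
qed

text \<open>The elements \<open>twist r \<otimes> w = w \<otimes> f r\<close> and
  \<open>r \<otimes> w\<close> correspond under \<open>f\<close> followed by inversion, and both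
  maps preserve length.\<close>

lemma cocycle_twist:
  assumes r: "r \<in> reflections W S"
  shows "cocycle w (twist r) \<longleftrightarrow> cocycle w r"
proof -
  have "f (r \<otimes> w) = inv (w \<otimes> f r)"
    using r f.hom_inv[of r] by (simp add: f.hom_mult inv_mult_group f_w)
  then have "cox_length W S (twist r \<otimes> w) = cox_length W S (r \<otimes> w)"
    using cox_length_f[of "r \<otimes> w"] cox_length_inv[of "w \<otimes> f r"] r by (simp add: twist_mult_w)
  then show ?thesis
    using cocycle_iff_cox_length[of w] r twist_reflection by simp
qed

text \<open>Perfection makes \<open>r\<close> commute with \<open>twist r\<close>. Hence
  \<open>twist r\<close> contributes nothing at \<open>r\<close>, and conjugation by it fixes
  \<open>r\<close>.\<close>

lemma cocycle_twist_mult: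
  assumes r: "r \<in> reflections W S" and ne: "twist r \<noteq> r"
  shows "cocycle (twist r \<otimes> w) r \<longleftrightarrow> cocycle w r"
proof -
  have comm: "twist r \<otimes> r = r \<otimes> twist r"
    using perfect[OF r] by (simp add: twist_def)
  have "\<not> cocycle (twist r) r"
    using cocycle_reflection_commuting[OF twist_reflection[OF r], of r] comm ne r by auto
  moreover have "twist r \<otimes> r \<otimes> twist r = r"
    using r twist_reflection[OF r] by (simp add: comm m_assoc)
  ultimately show ?thesis
    using cocycle_mult[of "twist r" w r] r twist_reflection[OF r] by simp
qed

text \<open>Multiplication by \<open>twist r\<close> goes the same way as multiplication by
  \<open>r\<close>, and does not alter the direction of the following step by \<open>r\<close>. Both
  steps therefore go up.\<close>

lemma cox_length_conj_up:
  assumes r: "r \<in> reflections W S" and ne: "twist r \<noteq> r" and "\<not> cocycle w r"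
  shows "cox_length W S w < cox_length W S (twist r \<otimes> w)"
    and "cox_length W S (twist r \<otimes> w) < cox_length W S (r \<otimes> (twist r \<otimes> w))"
  using assms cocycle_twist cocycle_twist_mult twist_reflection
  by (auto intro!: cox_length_greater_if_not_cocycle)

lemma cox_length_conj_down:
  assumes r: "r \<in> reflections W S" and ne: "twist r \<noteq> r" and "cocycle w r"
  shows "cox_length W S (r \<otimes> (twist r \<otimes> w)) < cox_length W S w"
proof -
  have "cox_length W S (r \<otimes> (twist r \<otimes> w)) < cox_length W S (twist r \<otimes> w)"
    using assms cocycle_twist_mult by (auto intro!: cox_length_less_if_cocycle)
  also have "\<dots> < cox_length W S w"
    using assms cocycle_twist by (auto intro!: cox_length_less_if_cocycle)
  finally show ?thesis .
qed

lemma twist_fixed_conj: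
  assumes "r \<in> reflections W S" "twist r = r"
  shows "r \<otimes> w \<otimes> f r = w"
  using assms conj_eq_twist[of r] by simp

section \<open>The two quasiparabolic axioms in terms of \<open>w\<close> and
  \<open>f\<close>\<close>

lemma twisted_QP1:
  assumes r: "r \<in> reflections W S" and eq: "cox_length W S (r \<otimes> w \<otimes> f r) = cox_length W S w"
  shows "r \<otimes> w \<otimes> f r = w"
proof (cases "twist r = r")
  case False
  have "cox_length W S (r \<otimes> (twist r \<otimes> w)) = cox_length W S w"
    using eq conj_eq_twist[of r] r by simp
  then show ?thesis
    using cox_length_conj_up[OF r False] cox_length_conj_down[OF r False] by fastforce
qed (use assms twist_fixed_conj in auto)

lemma twisted_QP2:
  assumes r: "r \<in> reflections W S" and s: "s \<in> S"
    and up: "cox_length W S w < cox_length W S (r \<otimes> w \<otimes> f r)"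
    and down: "cox_length W S (s \<otimes> (r \<otimes> w \<otimes> f r) \<otimes> f s) < cox_length W S (s \<otimes> w \<otimes> f s)"
  shows "r \<otimes> w \<otimes> f r = s \<otimes> w \<otimes> f s"
proof -
  let ?l = "cox_length W S"
  let ?t = "twist r"
  define x where "x = ?t \<otimes> w"
  define y where "y = r \<otimes> x"
  have c [simp]: "x \<in> carrier W" "y \<in> carrier W" "f s \<in> S"
    using r s f_S by (auto simp: x_def y_def)
  have y: "r \<otimes> w \<otimes> f r = y"
    using conj_eq_twist[of r] r by (simp only: x_def y_def reflection_closed)
  have ne: "?t \<noteq> r"
    using up r twist_fixed_conj by auto
  have nc: "\<not> cocycle w r"
    using cox_length_conj_down[OF r ne] up y by (auto simp: x_def y_def)
  have l1: "?l w < ?l x" and l2: "?l x < ?l y"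
    using cox_length_conj_up[OF r ne nc] by (auto simp: x_def y_def)
  have "?l y \<le> ?l (s \<otimes> y) + 1" "?l (s \<otimes> y) \<le> ?l (s \<otimes> y \<otimes> f s) + 1"
    "?l (s \<otimes> w) \<le> ?l w + 1" "?l (s \<otimes> w \<otimes> f s) \<le> ?l (s \<otimes> w) + 1"
    using s cox_length_gen_mult_ge cox_length_mult_gen_ge cox_length_gen_mult_le
      cox_length_mult_gen_le by auto
  moreover have "even (?l (s \<otimes> y \<otimes> f s)) = even (?l (s \<otimes> w \<otimes> f s))"
  proof -
    have "even (?l y) = even (?l w)"
      unfolding y[symmetric] using r cox_length_parity cox_length_f by auto
    then show ?thesis using s cox_length_parity by auto
  qed
  \<comment> \<open>By parity the drop in \<open>down\<close> is at least 2, so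
    \<open>?l y - 2\<close> \<le> \<open>?l (s \<otimes> y \<otimes> f s)\<close> \<le>
    \<open>?l (s \<otimes> w \<otimes> f s) - 2\<close> \<le> \<open>?l w\<close>. As
    \<open>?l y\<close> is at least \<open>?l w + 2\<close>, equality holds throughout.\<close>
  ultimately have lens: "?l x = ?l w + 1" "?l y = ?l w + 2" "?l (s \<otimes> y) = ?l w + 1"
    "?l (s \<otimes> w) = ?l w + 1"
    using l1 l2 down unfolding y by presburger+
  \<comment> \<open>Multiplication by \<open>s\<close> moves the length of \<open>x\<close> up or
    down. Since \<open>s \<otimes> y\<close>, \<open>x\<close> and \<open>s \<otimes> w\<close> all
    have length \<open>?l w + 1\<close>, going up gives the first case and going down the
    second.\<close>
  consider "?l (s \<otimes> y) < ?l (s \<otimes> x)" | "?l (s \<otimes> x) < ?l (s \<otimes> w)"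
    using lens cocycle_iff_cox_length[of x s] cox_length_greater_if_not_cocycle[of x s] s
    by fastforce
  then show ?thesis
  proof cases
    case 1
    then have "r = s"
      using regular_QP2[of x r s] l2 r s by (simp add: y_def)
    then show ?thesis by simp
  next
    case 2
    then have t: "?t = s"
      using regular_QP2[of w ?t s] l1 r s twist_reflection by (simp add: x_def)
    \<comment> \<open>As \<open>twist\<close> is an involution, \<open>r\<close> and
      \<open>s\<close> are exchanged by it; they also commute, so the two conjugates
      \<open>r \<otimes> (s \<otimes> w)\<close> and \<open>s \<otimes> (r \<otimes> w)\<close>
      agree.\<close>
    then have "twist s = r"
      using twist_twist r by auto
    have "r \<otimes> s = s \<otimes> r"
      using perfect[OF r] t by (simp add: twist_def)
    then have "r \<otimes> (s \<otimes> w) = s \<otimes> (r \<otimes> w)"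
      using r s m_assoc[of r s w] m_assoc[of s r w] by simp
    then show ?thesis
      using conj_eq_twist[of r] conj_eq_twist[of s] t \<open>twist s = r\<close> r s by simp
  qed
qed

end


section \<open>The conjugation action on perfect involutions\<close>

text \<open>Stability of \<open>X\<close> under every \<open>h g\<close> suffices for bijectivity,
  since the map of \<open>inv g\<close> is the inverse of the map of \<open>g\<close>.\<close>

lemma (in group_hom) conjugation_action:
  assumes X: "X \<subseteq> carrier H"
    and closed: "\<And>g x. g \<in> carrier G \<Longrightarrow> x \<in> X \<Longrightarrow> h g \<otimes>\<^bsub>H\<^esub> x \<otimes>\<^bsub>H\<^esub> inv\<^bsub>H\<^esub> h g \<in> X"
  shows "group_action G X (\<lambda>g. \<lambda>x\<in>X. h g \<otimes>\<^bsub>H\<^esub> x \<otimes>\<^bsub>H\<^esub> inv\<^bsub>H\<^esub> h g)"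
proof -
  let ?c = "\<lambda>g. \<lambda>x\<in>X. h g \<otimes>\<^bsub>H\<^esub> x \<otimes>\<^bsub>H\<^esub> inv\<^bsub>H\<^esub> h g"
  have mult: "?c (a \<otimes> b) = compose X (?c a) (?c b)" if "a \<in> carrier G" "b \<in> carrier G" for a b
    using that X closed
    by (auto simp: compose_def fun_eq_iff restrict_def H.m_assoc H.inv_mult_group subset_iff)
  have one: "?c \<one> = (\<lambda>x\<in>X. x)"
    using X by (auto simp: fun_eq_iff restrict_def subset_iff)
  have inverse: "?c (inv a) (?c a x) = x" if "a \<in> carrier G" "x \<in> X" for a x
    using fun_cong[OF mult[of "inv a" a], of x] fun_cong[OF one, of x] that
    by (simp add: compose_eq del: restrict_apply) (simp only: restrict_apply')
  have funcset: "?c a x \<in> X" if "a \<in> carrier G" "x \<in> X" for a x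
    using that closed by simp
  have bij: "?c a \<in> Bij X" if a: "a \<in> carrier G" for a
  proof -
    have "bij_betw (?c a) X X"
      using a inverse[of a] inverse[of "inv a"] funcset[of a] funcset[of "inv a"]
      by (intro bij_betwI[where g = "?c (inv a)"]) (auto simp del: restrict_apply restrict_apply')
    then show ?thesis by (simp add: Bij_def)
  qed
  show ?thesis
    unfolding group_action_def group_hom_def group_hom_axioms_def
  proof (intro conjI G.group_axioms group_BijGroup homI)
    fix a b assume "a \<in> carrier G" "b \<in> carrier G"
    then show "?c (a \<otimes> b) = ?c a \<otimes>\<^bsub>BijGroup X\<^esub> ?c b"
      using bij mult by (simp only: BijGroup_def monoid.simps restrict_apply')
  qed (use bij in \<open>simp add: BijGroup_def\<close>)
qed

context coxeter_system
begin

abbreviation P where "P \<equiv> extended_group W S"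

interpretation P: group P
  by (rule group_extended_group)

lemma ext_embed_hom: "ext_embed S \<in> hom W P"
proof -
  have "compose S (\<lambda>s\<in>S. s) (\<lambda>s\<in>S. s) = (\<lambda>s\<in>S. s)"
    by (auto simp: compose_def)
  then show ?thesis
    by (simp add: hom_def ext_embed_def extended_group_def induced_auto_id diagram_perms_id)
qed

interpretation E: group_hom W P "ext_embed S"
  by unfold_locales (rule ext_embed_hom)

text \<open>Moving the inverse of \<open>v\<close> to the left past \<open>\<pi>\<close> applies the
  induced automorphism to it; the permutation part is unchanged.\<close>

lemma ext_embed_conj:
  assumes "v \<in> carrier W" "w \<in> carrier W" "\<pi> \<in> diagram_perms W S"
  shows "ext_embed S v \<otimes>\<^bsub>P\<^esub> (w, \<pi>) \<otimes>\<^bsub>P\<^esub> inv\<^bsub>P\<^esub> ext_embed S v =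
    (v \<otimes> w \<otimes> inv (induced_auto W S \<pi> v), \<pi>)"
proof -
  interpret f: group_hom W W "induced_auto W S \<pi>"
    using induced_auto(1)[OF assms(3)] by unfold_locales (auto simp: auto_def)
  have "\<pi> \<in> extensional S" "\<pi> \<in> S \<rightarrow> S"
    using assms(3) diagram_perms_apply by (auto simp: diagram_perms_def Bij_def)
  then have "compose S (\<lambda>s\<in>S. s) \<pi> = \<pi>" "compose S \<pi> (\<lambda>s\<in>S. s) = \<pi>"
    by (auto simp: compose_def fun_eq_iff extensional_def Pi_def)
  then have "ext_embed S v \<otimes>\<^bsub>P\<^esub> (w, \<pi>) \<otimes>\<^bsub>P\<^esub> ext_embed S (inv v) =
      (v \<otimes> w \<otimes> inv (induced_auto W S \<pi> v), \<pi>)"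
    using assms by (simp add: extended_group_def ext_embed_def induced_auto_id f.hom_inv)
  then show ?thesis using assms by (simp add: E.hom_inv)
qed

text \<open>The passage from \<open>W\<^sup>+\<close> to \<open>W\<close>: the defining equations
  are read off by components, and uniqueness of induced automorphisms turns the square of
  \<open>\<pi>\<close> into the square of \<open>?f\<close>.\<close>

lemma perfect_involutionD:
  assumes "(w, \<pi>) \<in> perfect_involutions W S"
  shows "w \<in> carrier W" "\<pi> \<in> diagram_perms W S"
    "perfect_twisted_involution W S (induced_auto W S \<pi>) w"
proof -
  let ?f = "induced_auto W S \<pi>"
  let ?i = "(w, \<pi>)"
  have i: "?i \<in> carrier P" "?i \<otimes>\<^bsub>P\<^esub> ?i = \<one>\<^bsub>P\<^esub>"
    and perf: "\<And>r. r \<in> reflections W S \<Longrightarrow>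
      ext_embed S r \<otimes>\<^bsub>P\<^esub> (?i \<otimes>\<^bsub>P\<^esub> ext_embed S r \<otimes>\<^bsub>P\<^esub> ?i) =
      (?i \<otimes>\<^bsub>P\<^esub> ext_embed S r \<otimes>\<^bsub>P\<^esub> ?i) \<otimes>\<^bsub>P\<^esub> ext_embed S r"
    using assms by (auto simp: perfect_involutions_def Let_def)
  show w: "w \<in> carrier W" and \<pi>: "\<pi> \<in> diagram_perms W S"
    using i by (auto simp: extended_group_def)
  interpret f: group_hom W W ?f
    using induced_auto(1)[OF \<pi>] by unfold_locales (auto simp: auto_def)
  have sq: "w \<otimes> ?f w = \<one>" "compose S \<pi> \<pi> = (\<lambda>s\<in>S. s)"
    using i by (auto simp: extended_group_def)
  have "compose (carrier W) ?f ?f = (\<lambda>x\<in>carrier W. x)"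
    using induced_auto_compose[OF \<pi> \<pi>] sq induced_auto_id by simp
  then have ff: "?f (?f x) = x" if "x \<in> carrier W" for x
    using that by (metis compose_eq restrict_apply')
  have fw: "?f w = inv w"
    using sq w by (metis f.hom_closed inv_comm inv_equality)
  \<comment> \<open>The permutation part of the product is \<open>compose S \<pi> \<pi>\<close>, the
    identity, so the conjugate lies in the embedded copy of \<open>W\<close>; its last factor is
    \<open>?f w = inv w\<close>.\<close>
  have conj: "?i \<otimes>\<^bsub>P\<^esub> ext_embed S r \<otimes>\<^bsub>P\<^esub> ?i = ext_embed S (w \<otimes> ?f r \<otimes> inv w)"
    if "r \<in> carrier W" for r
  proof -
    have "\<pi> \<in> extensional S"
      using \<pi> by (auto simp: diagram_perms_def Bij_def)
    then have "compose S \<pi> (\<lambda>s\<in>S. s) = \<pi>"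
      by (auto simp: compose_def fun_eq_iff extensional_def)
    then show ?thesis
      using that by (simp add: extended_group_def ext_embed_def fw sq)
  qed
  show "perfect_twisted_involution W S ?f w"
  proof unfold_locales
    fix r assume r: "r \<in> reflections W S"
    then have "ext_embed S (r \<otimes> (w \<otimes> ?f r \<otimes> inv w)) = ext_embed S ((w \<otimes> ?f r \<otimes> inv w) \<otimes> r)"
      using perf[OF r] w by (simp add: conj E.hom_mult)
    then show "r \<otimes> (w \<otimes> ?f r \<otimes> inv w) = (w \<otimes> ?f r \<otimes> inv w) \<otimes> r"
      by (simp add: ext_embed_def)
  qed (use w \<pi> sq ff f.homh diagram_perms_apply in \<open>auto simp: induced_auto(2)\<close>)
qed

text \<open>Conjugation by \<open>v\<close> permutes the reflections: perfection of the conjugate at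
  \<open>r\<close> is the conjugate of perfection of \<open>i\<close> at
  \<open>inv v \<otimes> r \<otimes> v\<close>.\<close>

lemma perfect_involutions_conj:
  assumes i: "i \<in> perfect_involutions W S" and v: "v \<in> carrier W"
  shows "ext_embed S v \<otimes>\<^bsub>P\<^esub> i \<otimes>\<^bsub>P\<^esub> inv\<^bsub>P\<^esub> ext_embed S v \<in> perfect_involutions W S"
proof -
  let ?v = "ext_embed S v"
  let ?conj = "\<lambda>x. ?v \<otimes>\<^bsub>P\<^esub> x \<otimes>\<^bsub>P\<^esub> inv\<^bsub>P\<^esub> ?v"
  have vP: "?v \<in> carrier P" using v by simp
  have iP: "i \<in> carrier P" and sq: "i \<otimes>\<^bsub>P\<^esub> i = \<one>\<^bsub>P\<^esub>"
    and perf: "\<And>r. r \<in> reflections W S \<Longrightarrow>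
      ext_embed S r \<otimes>\<^bsub>P\<^esub> (i \<otimes>\<^bsub>P\<^esub> ext_embed S r \<otimes>\<^bsub>P\<^esub> i) =
      (i \<otimes>\<^bsub>P\<^esub> ext_embed S r \<otimes>\<^bsub>P\<^esub> i) \<otimes>\<^bsub>P\<^esub> ext_embed S r"
    using i by (auto simp: perfect_involutions_def Let_def)
  have cancel: "inv\<^bsub>P\<^esub> ?v \<otimes>\<^bsub>P\<^esub> (?v \<otimes>\<^bsub>P\<^esub> z) = z" "?v \<otimes>\<^bsub>P\<^esub> (inv\<^bsub>P\<^esub> ?v \<otimes>\<^bsub>P\<^esub> z) = z"
    if "z \<in> carrier P" for z
    using that vP by (simp_all add: P.m_assoc[symmetric])
  have cm: "?conj (x \<otimes>\<^bsub>P\<^esub> y) = ?conj x \<otimes>\<^bsub>P\<^esub> ?conj y" if "x \<in> carrier P" "y \<in> carrier P" for x y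
    using that vP by (simp add: P.m_assoc cancel)
  have "?conj i \<otimes>\<^bsub>P\<^esub> ?conj i = \<one>\<^bsub>P\<^esub>"
    using cm[of i i] iP sq vP by simp
  moreover have "ext_embed S r \<otimes>\<^bsub>P\<^esub> (?conj i \<otimes>\<^bsub>P\<^esub> ext_embed S r \<otimes>\<^bsub>P\<^esub> ?conj i) =
      (?conj i \<otimes>\<^bsub>P\<^esub> ext_embed S r \<otimes>\<^bsub>P\<^esub> ?conj i) \<otimes>\<^bsub>P\<^esub> ext_embed S r"
    if r: "r \<in> reflections W S" for r
  proof -
    let ?q = "inv v \<otimes> r \<otimes> v"
    have q: "?q \<in> reflections W S"
      using reflection_conj[OF r, of "inv v"] v by simp
    have "ext_embed S (v \<otimes> ?q \<otimes> inv v) = ?conj (ext_embed S ?q)"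
      using v r by (simp only: E.hom_mult E.hom_inv m_closed inv_closed reflection_closed)
    moreover have "v \<otimes> ?q \<otimes> inv v = r"
      using v r by (simp add: m_assoc)
    ultimately have rq: "ext_embed S r = ?conj (ext_embed S ?q)"
      by simp
    have "ext_embed S ?q \<in> carrier P" using q by (intro E.hom_closed) simp
    then show ?thesis
      using arg_cong[OF perf[OF q], of ?conj] iP unfolding rq by (simp only: cm P.m_closed)
  qed
  ultimately show ?thesis
    using iP vP by (auto simp: perfect_involutions_def Let_def)
qed

section \<open>The action in coordinates and the verification of the axioms\<close>

lemma ext_conjugation_action:
  "group_action W (perfect_involutions W S) (ext_conjugation W S (perfect_involutions W S))"
proof -
  have "perfect_involutions W S \<subseteq> carrier P"
    by (auto simp: perfect_involutions_def Let_def)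
  from E.conjugation_action[OF this perfect_involutions_conj]
  show ?thesis unfolding ext_conjugation_def[abs_def] Let_def by simp
qed

lemma ext_conjugation_apply:
  assumes "(w, \<pi>) \<in> perfect_involutions W S" "v \<in> carrier W"
  shows "ext_conjugation W S (perfect_involutions W S) v (w, \<pi>) =
    (v \<otimes> w \<otimes> inv (induced_auto W S \<pi> v), \<pi>)"
  using assms perfect_involutionD(1,2)[OF assms(1)]
  by (simp add: ext_conjugation_def Let_def ext_embed_conj)

lemma ext_conjugation_reflection:
  assumes "(w, \<pi>) \<in> perfect_involutions W S" "r \<in> reflections W S"
  shows "ext_conjugation W S (perfect_involutions W S) r (w, \<pi>) =
    (r \<otimes> w \<otimes> induced_auto W S \<pi> r, \<pi>)"
proof -
  interpret perfect_twisted_involution W S "induced_auto W S \<pi>" w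
    by (rule perfect_involutionD(3)[OF assms(1)])
  show ?thesis
    using assms ext_conjugation_apply f.hom_inv[of r] by simp
qed

theorem quasiparabolic_perfect_involutions:
  "quasiparabolic_set W S (perfect_involutions W S)
    (ext_conjugation W S (perfect_involutions W S)) (\<lambda>i. real (ext_length W S i) / 2)"
proof -
  let ?X = "perfect_involutions W S"
  let ?c = "ext_conjugation W S ?X"
  let ?ht = "\<lambda>i. real (ext_length W S i) / 2"
  let ?l = "cox_length W S"
  have closed: "?c v x \<in> ?X" if "v \<in> carrier W" "x \<in> ?X" for v x
    using that perfect_involutions_conj by (simp add: ext_conjugation_def Let_def)
  have int: "?ht (?c v x) - ?ht x \<in> \<int>" if v: "v \<in> carrier W" and x: "x \<in> ?X" for v x
  proof -
    obtain w \<pi> where wp: "x = (w, \<pi>)" "(w, \<pi>) \<in> ?X" using x by (cases x) auto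
    interpret perfect_twisted_involution W S "induced_auto W S \<pi>" w
      by (rule perfect_involutionD(3)[OF wp(2)])
    let ?n = "?l (v \<otimes> w \<otimes> inv (induced_auto W S \<pi> v))"
    \<comment> \<open>The factors \<open>v\<close> and the inverse of its image have equal length,
      so together they preserve parity; halving leaves an integer.\<close>
    have "even ?n = even (?l w)"
      using v cox_length_parity cox_length_inv cox_length_f by auto
    then have "even (int ?n - int (?l w))" by simp
    then obtain k where k: "int ?n - int (?l w) = 2 * k" by blast
    then have "real ?n - real (?l w) = 2 * of_int k" by linarith
    then have "?ht (?c v x) - ?ht x = of_int k"
      using wp v by (simp add: ext_conjugation_apply ext_length_def)
    then show ?thesis by simp
  qed
  have step: "\<bar>?ht (?c s x) - ?ht x\<bar> \<le> 1" if s: "s \<in> S" and x: "x \<in> ?X" for s x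
  proof -
    obtain w \<pi> where wp: "x = (w, \<pi>)" "(w, \<pi>) \<in> ?X" using x by (cases x) auto
    interpret perfect_twisted_involution W S "induced_auto W S \<pi>" w
      by (rule perfect_involutionD(3)[OF wp(2)])
    let ?t = "induced_auto W S \<pi> s"
    \<comment> \<open>Each of the two multiplications by a generator changes the length by at most
      1, hence the height by at most 1/2.\<close>
    have "?l w \<le> ?l (s \<otimes> w) + 1" "?l (s \<otimes> w) \<le> ?l w + 1"
      "?l (s \<otimes> w) \<le> ?l (s \<otimes> w \<otimes> ?t) + 1" "?l (s \<otimes> w \<otimes> ?t) \<le> ?l (s \<otimes> w) + 1"
      using s f_S cox_length_gen_mult_ge cox_length_mult_gen_ge cox_length_gen_mult_le
        cox_length_mult_gen_le by auto
    then show ?thesis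
      using wp s by (simp add: ext_conjugation_reflection ext_length_def abs_le_iff)
  qed
  have qp1: "?c r x = x" if r: "r \<in> reflections W S" and x: "x \<in> ?X" and eq: "?ht (?c r x) = ?ht x"
    for r x
  proof -
    obtain w \<pi> where wp: "x = (w, \<pi>)" "(w, \<pi>) \<in> ?X" using x by (cases x) auto
    interpret perfect_twisted_involution W S "induced_auto W S \<pi>" w
      by (rule perfect_involutionD(3)[OF wp(2)])
    show ?thesis
      using twisted_QP1[OF r] eq wp r by (simp add: ext_conjugation_reflection ext_length_def)
  qed
  have qp2: "?c r x = ?c s x" if r: "r \<in> reflections W S" and x: "x \<in> ?X" and s: "s \<in> S"
    and ht: "?ht (?c r x) > ?ht x" "?ht (?c s (?c r x)) < ?ht (?c s x)" for r x s
  proof -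
    obtain w \<pi> where wp: "x = (w, \<pi>)" "(w, \<pi>) \<in> ?X" using x by (cases x) auto
    interpret perfect_twisted_involution W S "induced_auto W S \<pi>" w
      by (rule perfect_involutionD(3)[OF wp(2)])
    \<comment> \<open>Needed to unfold the action of \<open>s\<close> on the conjugate by
      \<open>r\<close>; the permutation \<open>\<pi>\<close>, and so the automorphism, is the same
      as for \<open>x\<close>.\<close>
    have "(r \<otimes> w \<otimes> induced_auto W S \<pi> r, \<pi>) \<in> ?X"
      using closed[of r x] wp r by (simp add: ext_conjugation_reflection)
    then show ?thesis
      using twisted_QP2[OF r s] ht wp r s by (simp add: ext_conjugation_reflection ext_length_def)
  qed
  show ?thesis
    unfolding quasiparabolic_set_def scaled_set_def
    using ext_conjugation_action int step qp1 qp2 by blast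
qed

end

theorem theorem4p3:
  fixes W :: "('a, 'b) monoid_scheme" and S :: "'a set"
  assumes "coxeter_system W S"
  shows "quasiparabolic_set W S (perfect_involutions W S)
    (ext_conjugation W S (perfect_involutions W S))
    (\<lambda>\<iota>. real (ext_length W S \<iota>) / 2)"
  using assms by (rule coxeter_system.quasiparabolic_perfect_involutions)

end
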